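(* Let $u\ge 1$ be an integer. For all integers $n,k,r$ with $n\ge r\ge 0$ and $k\ge 1$, $$\sum_{\ell=1}^{n-r+1}\ell\, s_{n+1,n+1-\ell,r}^{x}(q)\,S_{n+ku-\ell,n,r}^{x}(q)=\sum_{\ell=1}^{n-r+1}\ell\,\overline{s}_{n+1,n+1-\ell,r}^{x^u}(q)\,\overline{S}_{n+k-\ell,n,r}^{x^u}(q).$$
   Context: Here $q$ is an indeterminate and $[m]_q=\frac{q^m-1}{q-1}$. For $p(x)\in\mathbb{Z}[x]$ and an integer $r\ge0$, define four arrays, each with value $1$ at $(n,k)=(r,r)$ and value $0$ for $k<r$, $k>n$ or $n<r$, by the following recursions for $r\le k\le n$, $n>r$. Type II, second kind: $S_{n,k,r}^{p(x)}(q)=S_{n-1,k-1,r}^{p(x)}(q)+[p(k)]_q S_{n-1,k,r}^{p(x)}(q)$. Type II, signed first kind: $s_{n,k,r}^{p(x)}(q)=s_{n-1,k-1,r}^{p(x)}(q)-[p(n-1)]_q s_{n-1,k,r}^{p(x)}(q)$. Type I, second kind: $\overline{S}_{n,k,r}^{p(x)}(q)=\overline{S}_{n-1,k-1,r}^{p(x)}(q)+p([k]_q)\overline{S}_{n-1,k,r}^{p(x)}(q)$. Type I, signed first kind: $\overline{s}_{n,k,r}^{p(x)}(q)=\overline{s}_{n-1,k-1,r}^{p(x)}(q)-p([n-1]_q)\overline{s}_{n-1,k,r}^{p(x)}(q)$. The superscripts $x$ and $x^u$ mean $p(x)=x$ and $p(x)=x^u$ respectively. *)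

theory Defs
  imports "HOL-Computational_Algebra.Fraction_Field" "HOL-Computational_Algebra.Polynomial"
begin

text \<open>
  All values live in the field of fractions of \<open>\<int>[q]\<close>, because \<open>[p(k)]\<^sub>q\<close> has negative
  powers of \<open>q\<close> when \<open>p(k) < 0\<close>.
\<close>

definition qvar :: "int poly fract" where
  "qvar = Fraction_Field.Fract [:0, 1:] 1"

definition qint :: "int \<Rightarrow> int poly fract" where
  "qint m = (qvar powi m - 1) / (qvar - 1)"

definition eval_int_poly :: "int poly \<Rightarrow> int poly fract \<Rightarrow> int poly fract" where
  "eval_int_poly p a = poly (map_poly of_int p) a"

text \<open>
  The arguments are \<open>p\<close>, \<open>n\<close>, \<open>k\<close>, \<open>r\<close>, in this order. The indices are integers, so
  the recursions may step outside the triangle \<open>r \<le> k \<le> n\<close>, where every array vanishes.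
  In the second branch of each definition \<open>n = r\<close> forces \<open>k = r\<close>.
\<close>

function S_II :: "int poly \<Rightarrow> int \<Rightarrow> int \<Rightarrow> int \<Rightarrow> int poly fract" where
  "S_II p n k r =
    (if k < r \<or> k > n \<or> n < r then 0
     else if n = r then 1
     else S_II p (n - 1) (k - 1) r + qint (poly p k) * S_II p (n - 1) k r)"
  by auto
termination by (relation "measure (\<lambda>(p, n, k, r). nat (n - r))") auto

function s_II :: "int poly \<Rightarrow> int \<Rightarrow> int \<Rightarrow> int \<Rightarrow> int poly fract" where
  "s_II p n k r =
    (if k < r \<or> k > n \<or> n < r then 0
     else if n = r then 1
     else s_II p (n - 1) (k - 1) r - qint (poly p (n - 1)) * s_II p (n - 1) k r)"
  by auto
termination by (relation "measure (\<lambda>(p, n, k, r). nat (n - r))") auto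

function S_I :: "int poly \<Rightarrow> int \<Rightarrow> int \<Rightarrow> int \<Rightarrow> int poly fract" where
  "S_I p n k r =
    (if k < r \<or> k > n \<or> n < r then 0
     else if n = r then 1
     else S_I p (n - 1) (k - 1) r + eval_int_poly p (qint k) * S_I p (n - 1) k r)"
  by auto
termination by (relation "measure (\<lambda>(p, n, k, r). nat (n - r))") auto

function s_I :: "int poly \<Rightarrow> int \<Rightarrow> int \<Rightarrow> int \<Rightarrow> int poly fract" where
  "s_I p n k r =
    (if k < r \<or> k > n \<or> n < r then 0
     else if n = r then 1
     else s_I p (n - 1) (k - 1) r - eval_int_poly p (qint (n - 1)) * s_I p (n - 1) k r)"
  by auto
termination by (relation "measure (\<lambda>(p, n, k, r). nat (n - r))") auto

declare S_II.simps [simp del] s_II.simps [simp del] S_I.simps [simp del] s_I.simps [simp del]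

end

theory Submission
  imports Defs "HOL-Computational_Algebra.Formal_Power_Series"
begin

text \<open>
  Both sides equal \<open>-(\<Sum>i=r..n. [i]\<^sub>q ^ (k u))\<close>. Each array depends on its polynomial only
  through a weight \<open>w\<close>: \<open>w i = [i]\<^sub>q\<close> on the left and \<open>w i = [i]\<^sub>q ^ u\<close> on the right. Unrolling
  the recursions, the second kind is a complete homogeneous symmetric function of the weights
  and the first kind is, up to sign, an elementary one:
  \<open>\<Sum>j. S(n+j, n, r) X^j = \<Prod>i=r..n. 1 / (1 - w i X)\<close> and
  \<open>\<Sum>l. s(n+1, n+1-l, r) X^l = \<Prod>i=r..n. (1 - w i X)\<close>
  (\<open>second_kind_generating_function\<close>, \<open>first_kind_generating_function\<close>). Write \<open>F\<close> for the
  second product. Then \<open>\<Sum>l. l s(n+1, n+1-l, r) S(n+m-l, n, r)\<close> is the coefficient of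
  \<open>X^m\<close> in \<open>X F' / F\<close>, and this logarithmic derivative is the negative of the generating
  function of the power sums \<open>\<Sum>i=r..n. w i ^ m\<close>, which is Newton's identity
  (\<open>weighted_convolution\<close>). The left side is the case \<open>m = k u\<close> for the weights \<open>[i]\<^sub>q\<close>, the
  right side the case \<open>m = k\<close> for the weights \<open>[i]\<^sub>q ^ u\<close>, and the two power sums coincide.
\<close>

definition linear_factor :: "'a::field \<Rightarrow> 'a fps" where
  "linear_factor a = 1 - fps_const a * fps_X"

definition geometric_fps :: "'a::field \<Rightarrow> 'a fps" where
  "geometric_fps a = Abs_fps (\<lambda>j. a ^ j)"

lemma nth_0_linear_factor [simp]: "fps_nth (linear_factor a) 0 = 1"
  by (simp add: linear_factor_def)

lemma nth_mult_linear_factor: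
  "fps_nth (F * linear_factor a) j
     = fps_nth F j - (if j = 0 then 0 else a * fps_nth F (j - 1))"
proof -
  have "F * linear_factor a = F - fps_const a * (fps_X * F)"
    by (simp add: linear_factor_def algebra_simps)
  then show ?thesis by simp
qed

lemma geometric_fps_mult_linear_factor: "geometric_fps a * linear_factor a = 1"
  by (rule fps_ext)
    (simp add: nth_mult_linear_factor geometric_fps_def power_eq_if)

text \<open>
  This is \<open>X F' / F = - (\<Sum>i. w i X / (1 - w i X))\<close> for \<open>F = \<Prod>i. (1 - w i X)\<close>, multiplied by
  \<open>F\<close> so that it needs no division of power series.
\<close>

lemma log_deriv_prod_linear_factor:
  fixes w :: "'i \<Rightarrow> 'a::field"
  assumes "finite I"
  shows "fps_X * fps_deriv (\<Prod>i\<in>I. linear_factor (w i))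
       = - (\<Prod>i\<in>I. linear_factor (w i))
           * (\<Sum>i\<in>I. fps_const (w i) * fps_X * geometric_fps (w i))"
  using assms
proof (induction I rule: finite_induct)
  case empty
  show ?case by simp
next
  case (insert a I)
  let ?F = "\<Prod>i\<in>I. linear_factor (w i)"
  let ?P = "\<Sum>i\<in>I. fps_const (w i) * fps_X * geometric_fps (w i)"
  let ?L = "linear_factor (w a)"
  let ?G = "geometric_fps (w a)"
  let ?c = "fps_const (w a) * fps_X"
  have "fps_deriv ?L = - fps_const (w a)"
    by (simp add: linear_factor_def)
  then have "fps_X * fps_deriv (?L * ?F) = ?L * (fps_X * fps_deriv ?F) - ?c * ?F"
    by (simp add: algebra_simps del: fps_const_neg)
  also have "\<dots> = ?L * (- ?F * ?P) - ?c * ?F * (?G * ?L)"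
    by (simp add: insert.IH geometric_fps_mult_linear_factor)
  also have "\<dots> = - (?L * ?F) * (?c * ?G + ?P)"
    by (simp add: algebra_simps)
  finally show ?case
    using insert.hyps by simp
qed

text \<open>
  The recursion says \<open>H n * (1 - w n X) = H (n - 1)\<close> for the series \<open>H n = \<Sum>j. A (n+j) n X^j\<close>,
  with \<open>1\<close> in place of \<open>H (r - 1)\<close> when \<open>n = r\<close>.
\<close>

lemma second_kind_generating_function:
  fixes A :: "int \<Rightarrow> int \<Rightarrow> 'a::field" and w :: "int \<Rightarrow> 'a"
  assumes rec: "\<And>n k. A n k = (if k < r \<or> k > n \<or> n < r then 0 else if n = r then 1
                               else A (n - 1) (k - 1) + w k * A (n - 1) k)"
    and "r \<le> n"
  shows "Abs_fps (\<lambda>j. A (n + int j) n) * (\<Prod>i=r..n. linear_factor (w i)) = 1"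
  using \<open>r \<le> n\<close>
proof (induction n rule: int_ge_induct)
  case base
  have "fps_nth (Abs_fps (\<lambda>j. A (r + int j) r) * linear_factor (w r)) j = fps_nth 1 j" for j
  proof (cases j)
    case 0
    then show ?thesis by (simp add: nth_mult_linear_factor rec[of r r])
  next
    case (Suc j')
    (* The diagonal predecessor has index r - 1 and vanishes. *)
    have "A (r + int j) r = w r * A (r + int j') r"
      using Suc by (subst rec) (simp add: rec[of _ "r - 1"])
    then show ?thesis using Suc by (simp add: nth_mult_linear_factor)
  qed
  then show ?case by (simp add: fps_eq_iff)
next
  case (step n)
  have "fps_nth (Abs_fps (\<lambda>j. A (n + 1 + int j) (n + 1)) * linear_factor (w (n + 1))) j
          = fps_nth (Abs_fps (\<lambda>j. A (n + int j) n)) j" for j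
  proof (cases j)
    case 0
    then show ?thesis
      using step.hyps rec[of "n + 1" "n + 1"] rec[of n "n + 1"]
      by (simp add: nth_mult_linear_factor)
  next
    case (Suc j')
    have "A (n + 1 + int j) (n + 1) = A (n + int j) n + w (n + 1) * A (n + 1 + int j') (n + 1)"
      using step.hyps Suc rec[of "n + 1 + int j" "n + 1"] by (simp add: algebra_simps)
    then show ?thesis using Suc by (simp add: nth_mult_linear_factor)
  qed
  then have "Abs_fps (\<lambda>j. A (n + 1 + int j) (n + 1)) * linear_factor (w (n + 1))
               = Abs_fps (\<lambda>j. A (n + int j) n)"
    by (simp add: fps_eq_iff)
  moreover have "{r..n + 1} = insert (n + 1) {r..n}"
    using step.hyps by auto
  ultimately show ?case
    using step.IH by (simp add: mult.assoc[symmetric])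
qed

lemma first_kind_generating_function:
  fixes B :: "int \<Rightarrow> int \<Rightarrow> 'a::field" and w :: "int \<Rightarrow> 'a"
  assumes rec: "\<And>n k. B n k = (if k < r \<or> k > n \<or> n < r then 0 else if n = r then 1
                               else B (n - 1) (k - 1) - w (n - 1) * B (n - 1) k)"
    and "r \<le> n"
  shows "Abs_fps (\<lambda>l. B n (n - int l)) = (\<Prod>i\<in>{r..<n}. linear_factor (w i))"
  using \<open>r \<le> n\<close>
proof (induction n rule: int_ge_induct)
  case base
  have "B r (r - int l) = (if l = 0 then 1 else 0)" for l
    by (subst rec) simp
  then show ?case by (simp add: fps_eq_iff)
next
  case (step n)
  have "B (n + 1) (n + 1 - int l)
          = fps_nth (Abs_fps (\<lambda>l. B n (n - int l)) * linear_factor (w n)) l" for l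
  proof -
    (* For n + 1 - l < r all three entries vanish, so the equation holds there too. *)
    have *: "B (n + 1) (n + 1 - int l) = B n (n - int l) - w n * B n (n + 1 - int l)"
      using step.hyps rec[of "n + 1" "n + 1 - int l"]
        rec[of n "n - int l"] rec[of n "n + 1 - int l"]
      by (auto simp: algebra_simps)
    show ?thesis
    proof (cases l)
      case 0
      have "B n (n + 1) = 0" by (subst rec) simp
      then show ?thesis using * 0 by (simp add: nth_mult_linear_factor)
    next
      case (Suc l')
      then show ?thesis using * by (simp add: nth_mult_linear_factor)
    qed
  qed
  then have "Abs_fps (\<lambda>l. B (n + 1) (n + 1 - int l))
               = Abs_fps (\<lambda>l. B n (n - int l)) * linear_factor (w n)"
    by (simp add: fps_eq_iff)
  moreover have "{r..<n + 1} = insert n {r..<n}"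
    using step.hyps by auto
  ultimately show ?case
    using step.IH by (simp add: mult.commute)
qed

text \<open>
  Newton's identity \<open>\<Sum>l. (-1)^(l-1) l e\<^sub>l h\<^sub>m\<^sub>-\<^sub>l = p\<^sub>m\<close> in the weights \<open>w r, \<dots>, w n\<close>: compare
  coefficients of \<open>X^m\<close> in \<open>X F' H\<close>, where \<open>F\<close> and \<open>H\<close> are the generating functions of \<open>B\<close> and
  \<open>A\<close> and \<open>F H = 1\<close>.
\<close>

lemma weighted_convolution:
  fixes A B :: "int \<Rightarrow> int \<Rightarrow> 'a::field" and w :: "int \<Rightarrow> 'a"
  assumes recA: "\<And>n k. A n k = (if k < r \<or> k > n \<or> n < r then 0 else if n = r then 1
                                else A (n - 1) (k - 1) + w k * A (n - 1) k)"
    and recB: "\<And>n k. B n k = (if k < r \<or> k > n \<or> n < r then 0 else if n = r then 1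
                                else B (n - 1) (k - 1) - w (n - 1) * B (n - 1) k)"
    and "r \<le> n" and "1 \<le> m"
  shows "(\<Sum>l = 1..n - r + 1. of_int l * B (n + 1) (n + 1 - l) * A (n + int m - l) n)
       = - (\<Sum>i=r..n. w i ^ m)"
proof -
  define H where "H = Abs_fps (\<lambda>j. A (n + int j) n)"
  define F where "F = Abs_fps (\<lambda>l. B (n + 1) (n + 1 - int l))"
  define P where "P = (\<Sum>i=r..n. fps_const (w i) * fps_X * geometric_fps (w i))"
  have "{r..<n + 1} = {r..n}" by auto
  then have F_prod: "F = (\<Prod>i=r..n. linear_factor (w i))"
    unfolding F_def using first_kind_generating_function[OF recB, of "n + 1"] \<open>r \<le> n\<close> by simp
  have HF: "H * F = 1"
    unfolding F_prod H_def by (rule second_kind_generating_function[OF recA \<open>r \<le> n\<close>])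
  have "fps_X * fps_deriv F * H = - P * (H * F)"
    using log_deriv_prod_linear_factor[of "{r..n}" w]
    unfolding F_prod[symmetric] P_def[symmetric] by (simp add: algebra_simps)
  then have log_deriv: "fps_X * fps_deriv F * H = - P"
    by (simp add: HF)
  have "fps_nth P m = (\<Sum>i=r..n. w i ^ m)"
  proof -
    have "fps_nth (fps_const a * fps_X * geometric_fps a) m = a ^ m" for a :: 'a
      using \<open>1 \<le> m\<close> by (simp add: mult.assoc geometric_fps_def power_eq_if)
    then show ?thesis by (simp add: P_def fps_sum_nth)
  qed
  moreover have "fps_nth (fps_X * fps_deriv F * H) m
      = (\<Sum>l = 0..m. of_nat l * B (n + 1) (n + 1 - int l) * A (n + int (m - l)) n)"
  proof -
    have "fps_nth (fps_X * fps_deriv F) l = of_nat l * fps_nth F l" for l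
      by (cases l) simp_all
    then show ?thesis by (simp add: fps_mult_nth F_def H_def)
  qed
  moreover have "(\<Sum>l = 0..m. of_nat l * B (n + 1) (n + 1 - int l) * A (n + int (m - l)) n)
      = (\<Sum>l = 1..n - r + 1. of_int l * B (n + 1) (n + 1 - l) * A (n + int m - l) n)"
  proof -
    let ?g = "\<lambda>l. of_int l * B (n + 1) (n + 1 - l) * A (n + int m - l) n"
    have "(\<Sum>l = 0..m. of_nat l * B (n + 1) (n + 1 - int l) * A (n + int (m - l)) n)
        = (\<Sum>l = 0..m. ?g (int l))"
      by (intro sum.cong refl) (simp add: of_nat_diff algebra_simps)
    also have "\<dots> = sum ?g {0..int m}"
      by (rule sum.reindex_bij_witness[of _ nat int]) auto
    (* The two ranges differ in zero terms: the factor l kills l = 0, B kills l > n - r + 1,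
       and A kills l > m. *)
    also have "\<dots> = sum ?g {1..n - r + 1}"
    proof (rule sum.mono_neutral_cong)
      fix l assume "l \<in> {0..int m} - {1..n - r + 1}"
      then show "?g l = 0"
        by (cases "l = 0") (auto simp: recB[of "n + 1" "n + 1 - l"])
    next
      fix l assume "l \<in> {1..n - r + 1} - {0..int m}"
      then show "?g l = 0" by (auto simp: recA[of "n + int m - l" n])
    qed auto
    finally show ?thesis .
  qed
  ultimately show ?thesis by (simp add: log_deriv)
qed

theorem theorem7p5:
  fixes u :: nat and n k r :: int
  assumes "u \<ge> 1" and "n \<ge> r" and "r \<ge> 0" and "k \<ge> 1"
  shows "(\<Sum>l = 1..n - r + 1.
            of_int l * s_II [:0, 1:] (n + 1) (n + 1 - l) r * S_II [:0, 1:] (n + k * int u - l) n r) =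
         (\<Sum>l = 1..n - r + 1.
            of_int l * s_I (monom 1 u) (n + 1) (n + 1 - l) r * S_I (monom 1 u) (n + k - l) n r)"
proof -
  define K where "K = nat k"
  have k: "k = int K" and "1 \<le> K" "1 \<le> K * u"
    using assms by (auto simp: K_def)
  have eval: "eval_int_poly (monom 1 u) a = a ^ u" for a
    by (simp add: eval_int_poly_def map_poly_monom poly_monom)
  have "(\<Sum>l = 1..n - r + 1. of_int l * s_II [:0, 1:] (n + 1) (n + 1 - l) r
            * S_II [:0, 1:] (n + int (K * u) - l) n r)
      = - (\<Sum>i=r..n. qint i ^ (K * u))"
  proof (rule weighted_convolution[where w = qint])
    show "S_II [:0, 1:] n k r = (if k < r \<or> k > n \<or> n < r then 0 else if n = r then 1
        else S_II [:0, 1:] (n - 1) (k - 1) r + qint k * S_II [:0, 1:] (n - 1) k r)" for n k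
      by (subst S_II.simps) simp
    show "s_II [:0, 1:] n k r = (if k < r \<or> k > n \<or> n < r then 0 else if n = r then 1
        else s_II [:0, 1:] (n - 1) (k - 1) r - qint (n - 1) * s_II [:0, 1:] (n - 1) k r)" for n k
      by (subst s_II.simps) simp
  qed fact+
  moreover have "(\<Sum>l = 1..n - r + 1. of_int l * s_I (monom 1 u) (n + 1) (n + 1 - l) r
            * S_I (monom 1 u) (n + int K - l) n r)
      = - (\<Sum>i=r..n. (qint i ^ u) ^ K)"
  proof (rule weighted_convolution[where w = "\<lambda>i. qint i ^ u"])
    show "S_I (monom 1 u) n k r = (if k < r \<or> k > n \<or> n < r then 0 else if n = r then 1
        else S_I (monom 1 u) (n - 1) (k - 1) r + qint k ^ u * S_I (monom 1 u) (n - 1) k r)" for n k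
      by (subst S_I.simps) (simp add: eval)
    show "s_I (monom 1 u) n k r = (if k < r \<or> k > n \<or> n < r then 0 else if n = r then 1
        else s_I (monom 1 u) (n - 1) (k - 1) r - qint (n - 1) ^ u * s_I (monom 1 u) (n - 1) k r)"
      for n k
      by (subst s_I.simps) (simp add: eval)
  qed fact+
  moreover have "(qint i ^ u) ^ K = qint i ^ (K * u)" for i
    by (simp add: power_mult[symmetric] mult.commute)
  ultimately show ?thesis
    by (simp add: k)
qed

end
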